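(* Let the system, the processes $x_t,u_t,w_t,\eta_t$, the $\sigma$-algebras $\mathcal{F}_t$, and the quantities $\Delta_t, H_t, \zeta_t, \vartheta, n_t$ be as in the context. Assume that for every $t\in\{0,\dots,N-1\}$: (A1) $u_t\in\mathcal{L}^2(\mathcal{F}_t)$, and (A2) $\mathbb{E}(|w_t|^4)<\infty$. Then for any $t\in\{1,\dots,N\}$, $H_t\in\mathcal{S}_{n_t}$ and $$\mathbb{E}(\Delta_t^2)=\mathbb{E}\big(\eta_t^\top H_t\eta_t+\zeta_t^\top\eta_t\big)+\vartheta .$$
   Context: Notation: $\mathcal{S}_n$ is the set of $n\times n$ real symmetric positive semidefinite matrices; $|\cdot|$ is the Euclidean norm; $y\in\mathcal{L}^2(\mathcal{F})$ means $y$ is an $\mathcal{F}$-measurable random vector with $\mathbb{E}(|y|^2)<\infty$; $\sigma(\cdot)$ is the $\sigma$-algebra generated by a random vector; a.s. means almost surely. System: fix $N\in\mathbb{N}=\{1,2,\dots\}$ and deterministic matrices $A\in\mathbb{R}^{n\times n}$, $B\in\mathbb{R}^{n\times m}$. On a probability space $(\Omega,\mathcal{G},\mathbb{P})$, consider $$x_{t+1}=Ax_t+Bu_t+w_t,\quad t\in\{0,\dots,N-1\},$$ where $x_t$ (state) and $w_t$ (disturbance) are $\mathbb{R}^n$-valued random vectors and $u_t$ (control) is an $\mathbb{R}^m$-valued random vector. The random vectors $x_0,w_0,\dots,w_{N-1}$ are independent, $w_0,\dots,w_{N-1}$ are identically distributed, and $x_0=\mathbf{x}_0$ a.s. for an arbitrary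 deterministic $\mathbf{x}_0\in\mathbb{R}^n$. Define $\mathcal{F}_t:=\sigma(h_t)$, where $h_0:=x_0$ and $h_t:=[x_0^\top,u_0^\top,\dots,x_{t-1}^\top,u_{t-1}^\top,x_t^\top]^\top$ for $t\in\{1,\dots,N\}$. Temporal coupling: fix a coupling length $\mathbf{k}\in\{0,\dots,N\}$ and a matrix $\mathcal{Q}\in\mathcal{S}_{n(\mathbf{k}+1)}$ partitioned into $n\times n$ blocks $Q_{ij}$, $i,j\in\{0,\dots,\mathbf{k}\}$ (block row $i$, block column $j$). For $t\in\{0,\dots,N\}$ let $\mathbf{k}_t:=\min\{\mathbf{k},t\}$, $n_t:=n(\mathbf{k}_t+1)$, $\eta_t:=[x_t^\top\;\cdots\;x_{t-\mathbf{k}_t}^\top]^\top$, let $\mathcal{Q}_t$ be the submatrix formed by the first $n_t$ rows and first $n_t$ columns of $\mathcal{Q}$, and let $z_t:=\eta_t^\top\mathcal{Q}_t\eta_t$. For $t\in\{1,\dots,N\}$ let $\Delta_t:=z_t-\mathbb{E}(z_t\mid\mathcal{F}_{t-1})$. Noise statistics (finite under the assumptions, and independent of $t$): $\bar w:=\mathbb{E}(w_{t-1})$, $d_t:=w_{t-1}-\bar w$ for $t\in\{1,\dots,N\}$, $\Sigma:=\mathbb{E}(d_td_t^\top)$, $\gamma:=\mathbb{E}(d_td_t^\top Q_{00}d_t)$, $\delta:=\mathrm{var}(d_t^\top Q_{00}d_t)$, and $\vartheta:=\delta-4\,\mathrm{tr}((\Sigma Q_{00})^2)$. For $t\in\{0,\dots,N\}$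 define $\zeta_t:=4[Q_{00}^\top\;\cdots\;Q_{\mathbf{k}_t0}^\top]^\top\gamma\in\mathbb{R}^{n_t}$ (the stacked vector with blocks $4Q_{i0}\gamma$, $i=0,\dots,\mathbf{k}_t$), and let $H_t$ be the $n_t\times n_t$ block matrix whose $(i,j)$ block is $4Q_{i0}\Sigma Q_{0j}$, $i,j\in\{0,\dots,\mathbf{k}_t\}$. *)

theory Defs
  imports "HOL-Probability.Probability"
begin

(* A square matrix whose rows and columns are indexed by a finite set I is a function of two
   indices; only its values on I matter. *)

definition quad_form :: "'i set \<Rightarrow> ('i \<Rightarrow> 'i \<Rightarrow> real) \<Rightarrow> ('i \<Rightarrow> real) \<Rightarrow> real" where
  "quad_form I M v = (\<Sum>p\<in>I. \<Sum>q\<in>I. v p * M p q * v q)"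

definition sym_psd :: "'i set \<Rightarrow> ('i \<Rightarrow> 'i \<Rightarrow> real) set" where
  "sym_psd I = {M. (\<forall>p\<in>I. \<forall>q\<in>I. M p q = M q p) \<and> (\<forall>v. 0 \<le> quad_form I M v)}"

(* Index set of block vectors with blocks 0, ..., K in R^n: the pair (i, a) is entry a of block i,
   so matrices over this set have size n(K+1).  For K' \<le> K, passing to block_idx K' is
   passing to the leading submatrix of size n(K'+1). *)

definition block_idx :: "nat \<Rightarrow> (nat \<times> 'n::finite) set" where
  "block_idx K = {0..K} \<times> UNIV"

lemma finite_block_idx [simp]: "finite (block_idx K)"
  by (simp add: block_idx_def)

lemma card_block_idx: "card (block_idx K :: (nat \<times> 'n::finite) set) = CARD('n) * (K + 1)"
  by (simp add: block_idx_def card_cartesian_product)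

type_synonym 'n block_vec = "nat \<times> 'n \<Rightarrow> real"
type_synonym 'n block_mat = "nat \<times> 'n \<Rightarrow> nat \<times> 'n \<Rightarrow> real"

definition blk :: "'n::finite block_mat \<Rightarrow> nat \<Rightarrow> nat \<Rightarrow> real^'n^'n" where
  "blk Q i j = (\<chi> a b. Q (i, a) (j, b))"

(* The sigma-algebra generated by x_0, u_0, ..., x_{t-1}, u_{t-1}, x_t. *)

definition hist_algebra ::
  "'a measure \<Rightarrow> (nat \<Rightarrow> 'a \<Rightarrow> real^'n::finite) \<Rightarrow> (nat \<Rightarrow> 'a \<Rightarrow> real^'m::finite) \<Rightarrow> nat \<Rightarrow> 'a measure" where
  "hist_algebra M x u t =
     vimage_algebra (space M)
       (\<lambda>\<omega>. (\<lambda>s\<in>{..t}. x s \<omega>, \<lambda>s\<in>{..<t}. u s \<omega>))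
       (PiM {..t} (\<lambda>_. borel) \<Otimes>\<^sub>M PiM {..<t} (\<lambda>_. borel))"

definition L2_vec :: "'a measure \<Rightarrow> 'a measure \<Rightarrow> ('a \<Rightarrow> real^'d::finite) \<Rightarrow> bool" where
  "L2_vec M F y \<longleftrightarrow> y \<in> borel_measurable F \<and> integrable M (\<lambda>\<omega>. (norm (y \<omega>))\<^sup>2)"

(* min k t is the effective coupling length at time t. *)

definition eta :: "(nat \<Rightarrow> 'a \<Rightarrow> real^'n::finite) \<Rightarrow> nat \<Rightarrow> 'a \<Rightarrow> 'n block_vec" where
  "eta x t \<omega> = (\<lambda>(i, a). x (t - i) \<omega> $ a)"

definition zcost ::
  "nat \<Rightarrow> 'n::finite block_mat \<Rightarrow> (nat \<Rightarrow> 'a \<Rightarrow> real^'n) \<Rightarrow> nat \<Rightarrow> 'a \<Rightarrow> real" where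
  "zcost k Q x t \<omega> = quad_form (block_idx (min k t)) Q (eta x t \<omega>)"

definition Delta ::
  "'a measure \<Rightarrow> nat \<Rightarrow> 'n::finite block_mat \<Rightarrow> (nat \<Rightarrow> 'a \<Rightarrow> real^'n) \<Rightarrow>
    (nat \<Rightarrow> 'a \<Rightarrow> real^'m::finite) \<Rightarrow> nat \<Rightarrow> 'a \<Rightarrow> real" where
  "Delta M k Q x u t \<omega> =
     zcost k Q x t \<omega> - real_cond_exp M (hist_algebra M x u (t - 1)) (zcost k Q x t) \<omega>"

(* Statistics of a noise vector v, with d = v - E v. *)

definition centered :: "'a measure \<Rightarrow> ('a \<Rightarrow> real^'n::finite) \<Rightarrow> 'a \<Rightarrow> real^'n" where
  "centered M v \<omega> = v \<omega> - (\<integral>\<xi>. v \<xi> \<partial>M)"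

definition noise_Sigma :: "'a measure \<Rightarrow> ('a \<Rightarrow> real^'n::finite) \<Rightarrow> real^'n^'n" where
  "noise_Sigma M v = (\<integral>\<omega>. (\<chi> a b. centered M v \<omega> $ a * centered M v \<omega> $ b) \<partial>M)"

definition noise_gamma ::
  "'a measure \<Rightarrow> real^'n^'n \<Rightarrow> ('a \<Rightarrow> real^'n::finite) \<Rightarrow> real^'n" where
  "noise_gamma M Q00 v =
     (\<integral>\<omega>. (centered M v \<omega> \<bullet> (Q00 *v centered M v \<omega>)) *\<^sub>R centered M v \<omega> \<partial>M)"

definition noise_delta :: "'a measure \<Rightarrow> real^'n^'n \<Rightarrow> ('a \<Rightarrow> real^'n::finite) \<Rightarrow> real" where
  "noise_delta M Q00 v =
     (let q = (\<lambda>\<omega>. centered M v \<omega> \<bullet> (Q00 *v centered M v \<omega>))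
      in \<integral>\<omega>. (q \<omega> - (\<integral>\<xi>. q \<xi> \<partial>M))\<^sup>2 \<partial>M)"

definition noise_theta :: "'a measure \<Rightarrow> real^'n^'n \<Rightarrow> ('a \<Rightarrow> real^'n::finite) \<Rightarrow> real" where
  "noise_theta M Q00 v =
     noise_delta M Q00 v
       - 4 * trace ((noise_Sigma M v ** Q00) ** (noise_Sigma M v ** Q00))"

(* Used on block_idx (min k t), these do not depend on t otherwise. *)

definition zeta_vec ::
  "'a measure \<Rightarrow> 'n::finite block_mat \<Rightarrow> ('a \<Rightarrow> real^'n) \<Rightarrow> 'n block_vec" where
  "zeta_vec M Q v = (\<lambda>(i, a). (4 *\<^sub>R (blk Q i 0 *v noise_gamma M (blk Q 0 0) v)) $ a)"

definition H_mat ::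
  "'a measure \<Rightarrow> 'n::finite block_mat \<Rightarrow> ('a \<Rightarrow> real^'n) \<Rightarrow> 'n block_mat" where
  "H_mat M Q v = (\<lambda>(i, a) (j, b). (4 *\<^sub>R (blk Q i 0 ** noise_Sigma M v ** blk Q 0 j)) $ a $ b)"

end

theory Submission
  imports Defs
begin

text \<open>
  Let \<open>d\<close> be the centred noise at time \<open>t - 1\<close>. The stacked state \<open>\<eta>\<close> at time \<open>t\<close> is \<open>y\<close> plus \<open>d\<close> in its
  first block, where \<open>y\<close> is measurable with respect to the history \<open>F\<close> up to time \<open>t - 1\<close>. This
  history is contained in the \<sigma>-algebra generated by the initial state and the noise up to time
  \<open>t - 2\<close>, and is therefore independent of \<open>d\<close>. With \<open>g\<close> the first block of \<open>Q y\<close> and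
  \<open>q = d \<bullet> Q00 d\<close>, the cost is \<open>y \<bullet> Q y + 2 g \<bullet> d + q\<close>, so its innovation is \<open>2 g \<bullet> d + (q - E q)\<close>, with
  second moment \<open>4 E(g \<bullet> \<Sigma> g) + 4 \<gamma> \<bullet> E g + \<delta>\<close>. On the other side, \<open>H\<close> and \<open>\<zeta>\<close> see \<open>\<eta>\<close> only through the
  first block \<open>G = g + Q00 d\<close> of \<open>Q \<eta>\<close>: the right-hand side is \<open>E(4 G \<bullet> \<Sigma> G + 4 \<gamma> \<bullet> G)\<close>, where
  replacing \<open>G\<close> by \<open>g\<close> costs exactly the trace term in \<open>\<vartheta>\<close>.
\<close>

section \<open>Block algebra of the stacked quadratic and linear forms\<close>

definition row0 :: "'n::finite block_mat \<Rightarrow> nat \<Rightarrow> 'n block_vec \<Rightarrow> 'n \<Rightarrow> real" where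
  "row0 Q K v a = (\<Sum>p\<in>block_idx K. Q (0, a) p * v p)"

lemma sum_block0:
  fixes f :: "nat \<times> 'n::finite \<Rightarrow> real"
  shows "(\<Sum>p\<in>block_idx K. if fst p = 0 then f p else 0) = (\<Sum>a\<in>UNIV. f (0, a))"
proof -
  have "(\<Sum>p\<in>block_idx K. if fst p = 0 then f p else 0)
      = (\<Sum>i\<in>{0..K}. \<Sum>a\<in>UNIV. if i = 0 then f (i, a) else 0)"
    unfolding block_idx_def by (simp add: sum.cartesian_product) (intro sum.cong, auto)
  also have "\<dots> = (\<Sum>i\<in>{0..K}. if i = 0 then (\<Sum>a\<in>UNIV. f (i, a)) else 0)"
    by (intro sum.cong) auto
  also have "\<dots> = (\<Sum>a\<in>UNIV. f (0, a))"
    by simp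
  finally show ?thesis .
qed

lemma row0_add_first_block:
  "row0 Q K (\<lambda>p. y p + (if fst p = 0 then d $ snd p else 0)) a
     = row0 Q K y a + (blk Q 0 0 *v d) $ a"
proof -
  have "(\<Sum>p\<in>block_idx K. Q (0, a) p * (if fst p = 0 then d $ snd p else 0))
      = (\<Sum>p\<in>block_idx K. if fst p = 0 then Q (0, a) p * d $ snd p else 0)"
    by (intro sum.cong) auto
  then show ?thesis
    unfolding row0_def distrib_left sum.distrib
    by (simp add: sum_block0 blk_def matrix_vector_mult_def)
qed

text \<open>Let \<open>e\<close> carry \<open>d\<close> in block 0 and zeros elsewhere. Expanding
  the form at \<open>y + e\<close> gives two cross terms, equal by symmetry of \<open>Q\<close>.
  Every sum against \<open>e\<close> collapses to block 0, so only the first block of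
  \<open>Q y\<close> and the corner block of \<open>Q\<close> enter.\<close>

lemma quad_form_add_first_block:
  assumes sym: "\<And>p q. p \<in> block_idx K \<Longrightarrow> q \<in> block_idx K \<Longrightarrow> Q p q = Q q p"
  shows "quad_form (block_idx K) Q (\<lambda>p. y p + (if fst p = 0 then d $ snd p else 0))
     = quad_form (block_idx K) Q y + 2 * (\<Sum>a\<in>UNIV. d $ a * row0 Q K y a)
         + d \<bullet> (blk Q 0 0 *v d)"
proof -
  let ?I = "block_idx K :: (nat \<times> 'a) set"
  let ?e = "\<lambda>p. if fst p = 0 then d $ snd p else 0"
  have e: "(\<Sum>p\<in>?I. ?e p * f p) = (\<Sum>a\<in>UNIV. d $ a * f (0, a))" for f :: "nat \<times> 'a \<Rightarrow> real"
    using sum_block0[of "\<lambda>p. d $ snd p * f p" K]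
    by (simp add: if_distrib[of "\<lambda>s. s * _"] cong: if_cong)
  have "quad_form ?I Q (\<lambda>p. y p + ?e p) = quad_form ?I Q y
      + (\<Sum>p\<in>?I. \<Sum>q\<in>?I. y p * Q p q * ?e q) + (\<Sum>p\<in>?I. \<Sum>q\<in>?I. ?e p * Q p q * y q)
      + (\<Sum>p\<in>?I. \<Sum>q\<in>?I. ?e p * Q p q * ?e q)"
    unfolding quad_form_def distrib_left distrib_right sum.distrib by (simp add: algebra_simps)
  moreover have "(\<Sum>p\<in>?I. \<Sum>q\<in>?I. y p * Q p q * ?e q) = (\<Sum>q\<in>?I. \<Sum>p\<in>?I. ?e q * Q q p * y p)"
    by (subst sum.swap) (intro sum.cong refl, simp add: sym)
  moreover have "(\<Sum>p\<in>?I. \<Sum>q\<in>?I. ?e p * Q p q * y q) = (\<Sum>a\<in>UNIV. d $ a * row0 Q K y a)"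
    using e[of "\<lambda>p. \<Sum>q\<in>?I. Q p q * y q"] by (simp add: row0_def sum_distrib_left mult.assoc)
  moreover have "(\<Sum>p\<in>?I. \<Sum>q\<in>?I. ?e p * Q p q * ?e q)
      = (\<Sum>p\<in>?I. ?e p * (\<Sum>q\<in>?I. ?e q * Q p q))"
    by (simp add: sum_distrib_left mult_ac)
  then have "(\<Sum>p\<in>?I. \<Sum>q\<in>?I. ?e p * Q p q * ?e q) = d \<bullet> (blk Q 0 0 *v d)"
    unfolding e by (simp add: inner_vec_def matrix_vector_mult_def blk_def mult.commute)
  ultimately show ?thesis
    by simp
qed

lemma H_mat_eq:
  "H_mat M Q v p q
     = 4 * (\<Sum>a\<in>UNIV. \<Sum>b\<in>UNIV. noise_Sigma M v $ a $ b * (Q p (0, a) * Q (0, b) q))"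
proof -
  have "H_mat M Q v p q
      = 4 * (\<Sum>b\<in>UNIV. \<Sum>a\<in>UNIV. noise_Sigma M v $ a $ b * (Q p (0, a) * Q (0, b) q))"
    by (simp add: H_mat_def case_prod_unfold matrix_matrix_mult_def blk_def
        sum_distrib_left sum_distrib_right mult_ac)
  then show ?thesis by (subst sum.swap)
qed

text \<open>By symmetry of \<open>Q\<close>, H is 4 C Sigma C^T with C the block column 0 of
  \<open>Q\<close>, and C^T \<eta> is the first block of \<open>Q\<close> \<eta>. Positivity of H
  thereby reduces to that of Sigma.\<close>

lemma quad_form_H_mat:
  assumes sym: "\<And>p q. p \<in> block_idx K \<Longrightarrow> q \<in> block_idx K \<Longrightarrow> Q p q = Q q p"
  shows "quad_form (block_idx K) (H_mat M Q v) \<eta>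
     = 4 * (\<Sum>a\<in>UNIV. \<Sum>b\<in>UNIV. noise_Sigma M v $ a $ b * (row0 Q K \<eta> a * row0 Q K \<eta> b))"
proof -
  let ?I = "block_idx K :: (nat \<times> 'a) set" and ?S = "noise_Sigma M v"
  have "quad_form ?I (H_mat M Q v) \<eta> = (\<Sum>p\<in>?I. \<Sum>q\<in>?I. \<Sum>a\<in>UNIV. \<Sum>b\<in>UNIV.
      4 * ?S $ a $ b * (Q p (0, a) * \<eta> p) * (Q (0, b) q * \<eta> q))"
    unfolding quad_form_def H_mat_eq by (simp add: sum_distrib_left sum_distrib_right mult_ac)
  also have "\<dots> = (\<Sum>a\<in>UNIV. \<Sum>b\<in>UNIV. \<Sum>p\<in>?I. \<Sum>q\<in>?I.
      4 * ?S $ a $ b * (Q p (0, a) * \<eta> p) * (Q (0, b) q * \<eta> q))"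
    \<comment> \<open>Four exchanges of adjacent sums reconcile the order p, q, a, b with a, b, p,
      q.\<close>
    by (subst (2) sum.swap, subst sum.swap, subst (3) sum.swap, subst (2) sum.swap, rule refl)
  also have "\<dots> = (\<Sum>a\<in>UNIV. \<Sum>b\<in>UNIV.
      4 * ?S $ a $ b * ((\<Sum>p\<in>?I. Q p (0, a) * \<eta> p) * (\<Sum>q\<in>?I. Q (0, b) q * \<eta> q)))"
    unfolding sum_product unfolding sum_distrib_left by (simp only: mult.assoc)
  also have "\<dots> = (\<Sum>a\<in>UNIV. \<Sum>b\<in>UNIV. 4 * ?S $ a $ b * (row0 Q K \<eta> a * row0 Q K \<eta> b))"
  proof -
    have "(\<Sum>p\<in>?I. Q p (0, a) * \<eta> p) = row0 Q K \<eta> a" for a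
      unfolding row0_def by (intro sum.cong refl, subst sym) (auto simp: block_idx_def)
    then show ?thesis by (simp add: row0_def)
  qed
  finally show ?thesis by (simp add: sum_distrib_left mult_ac)
qed

text \<open>The vector is 4 C gamma with the same block column C; the pairing moves C, transposed,
  onto \<eta>.\<close>

lemma sum_zeta_vec:
  assumes sym: "\<And>p q. p \<in> block_idx K \<Longrightarrow> q \<in> block_idx K \<Longrightarrow> Q p q = Q q p"
  shows "(\<Sum>p\<in>block_idx K. zeta_vec M Q v p * \<eta> p)
     = 4 * (\<Sum>a\<in>UNIV. noise_gamma M (blk Q 0 0) v $ a * row0 Q K \<eta> a)"
proof -
  have "(\<Sum>p\<in>block_idx K. zeta_vec M Q v p * \<eta> p) = (\<Sum>p\<in>block_idx K. \<Sum>a\<in>UNIV.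
      4 * (noise_gamma M (blk Q 0 0) v $ a * (Q (0, a) p * \<eta> p)))"
  proof (intro sum.cong refl)
    fix p :: "nat \<times> 'a" assume p: "p \<in> block_idx K"
    have "Q p (0, a) = Q (0, a) p" for a
      using p by (intro sym) (auto simp: block_idx_def)
    then show "zeta_vec M Q v p * \<eta> p
        = (\<Sum>a\<in>UNIV. 4 * (noise_gamma M (blk Q 0 0) v $ a * (Q (0, a) p * \<eta> p)))"
      by (simp add: zeta_vec_def case_prod_unfold matrix_vector_mult_def blk_def
          sum_distrib_right sum_distrib_left mult_ac)
  qed
  also have "\<dots> = 4 * (\<Sum>a\<in>UNIV. noise_gamma M (blk Q 0 0) v $ a * row0 Q K \<eta> a)"
    unfolding row0_def by (subst sum.swap) (simp add: sum_distrib_left)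
  finally show ?thesis .
qed

section \<open>Square integrability, componentwise integrals and fourth moments\<close>

lemma integrable_square_add:
  fixes f g :: "'a \<Rightarrow> real"
  assumes [measurable]: "f \<in> borel_measurable M" "g \<in> borel_measurable M"
    and "integrable M (\<lambda>x. (f x)\<^sup>2)" "integrable M (\<lambda>x. (g x)\<^sup>2)"
  shows "integrable M (\<lambda>x. (f x + g x)\<^sup>2)"
proof (rule Bochner_Integration.integrable_bound)
  show "integrable M (\<lambda>x. 2 * (f x)\<^sup>2 + 2 * (g x)\<^sup>2)"
    using assms by simp
  show "AE x in M. norm ((f x + g x)\<^sup>2) \<le> norm (2 * (f x)\<^sup>2 + 2 * (g x)\<^sup>2)"
  proof (rule AE_I2)
    fix x
    have "0 \<le> (f x - g x)\<^sup>2" by simp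
    then have "(f x + g x)\<^sup>2 \<le> 2 * (f x)\<^sup>2 + 2 * (g x)\<^sup>2"
      by (simp add: power2_eq_square algebra_simps)
    then show "norm ((f x + g x)\<^sup>2) \<le> norm (2 * (f x)\<^sup>2 + 2 * (g x)\<^sup>2)"
      by simp
  qed
qed measurable

lemma integrable_square_sum:
  fixes f :: "'i \<Rightarrow> 'a \<Rightarrow> real"
  assumes "finite I" "\<And>i. i \<in> I \<Longrightarrow> f i \<in> borel_measurable M"
    and "\<And>i. i \<in> I \<Longrightarrow> integrable M (\<lambda>x. (f i x)\<^sup>2)"
  shows "integrable M (\<lambda>x. (\<Sum>i\<in>I. f i x)\<^sup>2)"
  using assms
proof (induction I rule: finite_induct)
  case (insert i I)
  then have [measurable]: "f i \<in> borel_measurable M" "(\<lambda>x. \<Sum>i\<in>I. f i x) \<in> borel_measurable M"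
    by auto
  show ?case
    using insert by (simp add: integrable_square_add)
qed simp

text \<open>Polarization: the product is half of (f + g)^2 - f^2 - g^2.\<close>

lemma integrable_mult_of_squares:
  fixes f g :: "'a \<Rightarrow> real"
  assumes [measurable]: "f \<in> borel_measurable M" "g \<in> borel_measurable M"
    and "integrable M (\<lambda>x. (f x)\<^sup>2)" "integrable M (\<lambda>x. (g x)\<^sup>2)"
  shows "integrable M (\<lambda>x. f x * g x)"
proof -
  have "integrable M (\<lambda>x. ((f x + g x)\<^sup>2 - (f x)\<^sup>2 - (g x)\<^sup>2) / 2)"
    using integrable_square_add[OF assms] assms(3,4) by simp
  then show ?thesis
    by (simp add: power2_sum)
qed

lemma vec_eq_sum_axis: "(v :: real^'n) = (\<Sum>a\<in>UNIV. v $ a *\<^sub>R axis a 1)"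
  by (simp add: vec_eq_iff axis_def if_distrib cong: if_cong)

text \<open>A non-integrable function has integral 0 by convention, so a coordinate cannot be pulled
  out unconditionally. Integrable components make the vector integrable through its finite basis
  expansion; the coordinate, a bounded linear map, then commutes with the integral.\<close>

lemma integral_vec_nth:
  fixes f :: "'a \<Rightarrow> real^'n::finite"
  assumes "\<And>a. integrable M (\<lambda>x. f x $ a)"
  shows "integral\<^sup>L M f $ a = (\<integral>x. f x $ a \<partial>M)"
proof -
  have "integrable M (\<lambda>x. \<Sum>a\<in>UNIV. f x $ a *\<^sub>R axis a (1::real))"
    using assms by (intro Bochner_Integration.integrable_sum integrable_scaleR_left) auto
  then have "integrable M f"
    by (simp flip: vec_eq_sum_axis)
  then show ?thesis
    by (rule integral_bounded_linear[OF bounded_linear_vec_nth, symmetric])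
qed

lemma integral_mat_nth:
  fixes f :: "'a \<Rightarrow> real^'n::finite^'m::finite"
  assumes "\<And>a b. integrable M (\<lambda>x. f x $ a $ b)"
  shows "integral\<^sup>L M f $ a $ b = (\<integral>x. f x $ a $ b \<partial>M)"
proof -
  have "integrable M (\<lambda>x. \<Sum>a\<in>UNIV. \<Sum>b\<in>UNIV. f x $ a $ b *\<^sub>R axis a (axis b (1::real)))"
    using assms by (intro Bochner_Integration.integrable_sum integrable_scaleR_left) auto
  moreover have "(\<Sum>a\<in>UNIV. \<Sum>b\<in>UNIV. f x $ a $ b *\<^sub>R axis a (axis b (1::real))) = f x" for x
  proof -
    have "(\<Sum>b\<in>UNIV. if c then h b else 0) = (if c then \<Sum>b\<in>UNIV. h b else 0)"
      for c and h :: "'n \<Rightarrow> real"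
      by simp
    then show ?thesis
      by (simp add: vec_eq_iff axis_def if_distrib[of "\<lambda>v. v $ _"] if_distrib[of "\<lambda>v. _ * v"]
          cong: if_cong)
  qed
  ultimately have "integrable M f"
    by simp
  then have "integral\<^sup>L M f $ a $ b = (\<integral>x. f x $ a \<partial>M) $ b" "integrable M (\<lambda>x. f x $ a)"
    using integral_bounded_linear[OF bounded_linear_vec_nth, of M f a]
      integrable_bounded_linear[OF bounded_linear_vec_nth, of M f a] by auto
  then show ?thesis
    using assms by (simp add: integral_vec_nth)
qed

text \<open>Lets one fourth moment control all lower moments under a finite measure: the summand 1
  dominates on the unit ball, and outside it powers grow with the exponent.\<close>

lemma norm_le_one_plus_pow4:
  fixes v :: "'b::real_normed_vector"
  assumes "j \<le> 4"
  shows "norm v ^ j \<le> 1 + norm v ^ 4"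
proof (cases "norm v \<le> 1")
  case True
  then have "norm v ^ j \<le> 1"
    by (simp add: power_le_one)
  then show ?thesis
    by (simp add: add_increasing2)
next
  case False
  then have "norm v ^ j \<le> norm v ^ 4"
    using assms by (intro power_increasing) auto
  then show ?thesis
    by simp
qed

lemma (in finite_measure) integrable_norm_pow_le4:
  fixes v :: "'a \<Rightarrow> 'b::{banach, second_countable_topology}"
  assumes [measurable]: "v \<in> borel_measurable M" and "integrable M (\<lambda>\<omega>. norm (v \<omega>) ^ 4)" "j \<le> 4"
  shows "integrable M (\<lambda>\<omega>. norm (v \<omega>) ^ j)"
proof (rule Bochner_Integration.integrable_bound)
  show "integrable M (\<lambda>\<omega>. 1 + norm (v \<omega>) ^ 4)"
    using assms by simp
  show "AE \<omega> in M. norm (norm (v \<omega>) ^ j) \<le> norm (1 + norm (v \<omega>) ^ 4)"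
    by (intro AE_I2) (simp add: norm_le_one_plus_pow4[OF assms(3)])
qed measurable

lemma (in finite_measure) integrable_norm_diff_pow4:
  fixes v :: "'a \<Rightarrow> 'b::{banach, second_countable_topology}"
  assumes [measurable]: "v \<in> borel_measurable M" and "integrable M (\<lambda>\<omega>. norm (v \<omega>) ^ 4)"
  shows "integrable M (\<lambda>\<omega>. norm (v \<omega> - m) ^ 4)"
proof (rule Bochner_Integration.integrable_bound)
  \<comment> \<open>The constant 8 comes from using (a + b)^2 <= 2 (a^2 + b^2) twice, first for the
    norms and then for their squares.\<close>
  show "integrable M (\<lambda>\<omega>. 8 * (norm (v \<omega>) ^ 4 + norm m ^ 4))"
    using assms by simp
  have sq: "(a + b)\<^sup>2 \<le> 2 * (a\<^sup>2 + b\<^sup>2)" for a b :: real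
    using zero_le_power2[of "a - b"] by (simp add: power2_eq_square algebra_simps)
  have "(a + b) ^ 4 \<le> 8 * (a ^ 4 + b ^ 4)" for a b :: real
  proof -
    have "((a + b)\<^sup>2)\<^sup>2 \<le> (2 * (a\<^sup>2 + b\<^sup>2))\<^sup>2"
      by (intro power_mono sq) auto
    also have "\<dots> \<le> 8 * ((a\<^sup>2)\<^sup>2 + (b\<^sup>2)\<^sup>2)"
      using sq[of "a\<^sup>2" "b\<^sup>2"] unfolding power_mult_distrib by simp
    finally show ?thesis
      by simp
  qed
  moreover have "norm (v \<omega> - m) ^ 4 \<le> (norm (v \<omega>) + norm m) ^ 4" for \<omega>
    by (intro power_mono norm_triangle_ineq4) auto
  ultimately have "norm (v \<omega> - m) ^ 4 \<le> 8 * (norm (v \<omega>) ^ 4 + norm m ^ 4)" for \<omega>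
    by (rule order_trans[rotated])
  then show "AE \<omega> in M. norm (norm (v \<omega> - m) ^ 4) \<le> norm (8 * (norm (v \<omega>) ^ 4 + norm m ^ 4))"
    by simp
qed measurable

lemma borel_measurable_vec_nth [measurable (raw)]:
  fixes v :: "'a \<Rightarrow> real^'n::finite"
  assumes "v \<in> borel_measurable M"
  shows "(\<lambda>\<omega>. v \<omega> $ a) \<in> borel_measurable M"
  using borel_measurable_continuous_on[OF continuous_on_component[OF continuous_on_id] assms] by simp

lemma integrable_square_nth:
  fixes v :: "'a \<Rightarrow> real^'n::finite"
  assumes [measurable]: "v \<in> borel_measurable M" and "integrable M (\<lambda>\<omega>. (norm (v \<omega>))\<^sup>2)"
  shows "integrable M (\<lambda>\<omega>. (v \<omega> $ a)\<^sup>2)"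
  using assms(2)
proof (rule Bochner_Integration.integrable_bound)
  have "(v \<omega> $ a)\<^sup>2 \<le> (norm (v \<omega>))\<^sup>2" for \<omega>
    using component_le_norm_cart[of "v \<omega>" a] by (simp flip: abs_le_square_iff)
  then show "AE \<omega> in M. norm ((v \<omega> $ a)\<^sup>2) \<le> norm ((norm (v \<omega>))\<^sup>2)"
    by simp
qed measurable

lemma integrable_square_matrix_vector:
  fixes v :: "'a \<Rightarrow> real^'m::finite" and A :: "real^'m^'n::finite"
  assumes [measurable]: "v \<in> borel_measurable M" and sq: "\<And>b. integrable M (\<lambda>\<omega>. (v \<omega> $ b)\<^sup>2)"
  shows "integrable M (\<lambda>\<omega>. ((A *v v \<omega>) $ a)\<^sup>2)"
  unfolding matrix_vector_mult_def
  by (simp, rule integrable_square_sum) (use sq in \<open>auto simp: power_mult_distrib\<close>)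

text \<open>Reorders the four sums of a trace so that one covariance factor depends on the two outer
  indices only; used for \<open>integral_quad_shifted\<close>.\<close>

lemma sum_swap4:
  fixes f :: "'a \<Rightarrow> 'b \<Rightarrow> 'c \<Rightarrow> 'd \<Rightarrow> 'e::comm_monoid_add"
  shows "(\<Sum>a\<in>A. \<Sum>b\<in>B. \<Sum>c\<in>C. \<Sum>e\<in>E. f a b c e) = (\<Sum>e\<in>E. \<Sum>b\<in>B. \<Sum>a\<in>A. \<Sum>c\<in>C. f a b c e)"
proof -
  have "(\<Sum>a\<in>A. \<Sum>b\<in>B. \<Sum>c\<in>C. \<Sum>e\<in>E. f a b c e) = (\<Sum>b\<in>B. \<Sum>a\<in>A. \<Sum>e\<in>E. \<Sum>c\<in>C. f a b c e)"
    by (subst sum.swap[where A=A], intro sum.cong refl, rule sum.swap)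
  also have "\<dots> = (\<Sum>b\<in>B. \<Sum>e\<in>E. \<Sum>a\<in>A. \<Sum>c\<in>C. f a b c e)"
    by (intro sum.cong refl, rule sum.swap)
  also have "\<dots> = (\<Sum>e\<in>E. \<Sum>b\<in>B. \<Sum>a\<in>A. \<Sum>c\<in>C. f a b c e)"
    by (rule sum.swap)
  finally show ?thesis .
qed

section \<open>Independence of sigma-algebras and of functions measurable for them\<close>

lemma (in prob_space) indep_set_mono:
  assumes "indep_set A B" "A' \<subseteq> A" "B' \<subseteq> B"
  shows "indep_set A' B'"
  unfolding indep_set_def
proof (rule indep_sets_mono_sets[OF assms(1)[unfolded indep_set_def]])
  show "case_bool A' B' i \<subseteq> case_bool A B i" for i
    using assms(2,3) by (cases i) (simp_all only: bool.case)
qed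

text \<open>\<open>indep_var\<close> speaks of the sigma-algebras generated by \<open>f\<close> and
  \<open>g\<close>. By measurability these lie inside \<open>F\<close> and \<open>G\<close>, and
  independence passes to smaller families.\<close>

lemma (in prob_space) indep_set_imp_indep_var:
  assumes "indep_set (sets F) (sets G)" "subalgebra M F" "subalgebra M G"
    and f: "f \<in> measurable F S" and g: "g \<in> measurable G T"
  shows "indep_var S f T g"
proof -
  have sp: "space F = space M" "space G = space M"
    using assms(2,3) by (auto simp: subalgebra_def)
  have rv: "random_variable S f" "random_variable T g"
    using measurable_from_subalg[OF assms(2) f] measurable_from_subalg[OF assms(3) g] by auto
  have le_F: "sigma_sets (space M) {f -` A \<inter> space M |A. A \<in> sets S} \<subseteq> sets F"
    using measurable_sets[OF f] unfolding sp(1)[symmetric] by (intro sets.sigma_sets_subset) auto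
  have le_G: "sigma_sets (space M) {g -` A \<inter> space M |A. A \<in> sets T} \<subseteq> sets G"
    using measurable_sets[OF g] unfolding sp(2)[symmetric] by (intro sets.sigma_sets_subset) auto
  show ?thesis
    unfolding indep_var_eq by (intro conjI rv indep_set_mono[OF assms(1) le_F le_G])
qed

section \<open>A centred noise vector with finite fourth moment, independent of a sigma-algebra
  \<open>F\<close>\<close>

locale independent_noise = prob_space M for M :: "'a measure" +
  fixes F :: "'a measure" and d :: "'a \<Rightarrow> real^'n::finite"
  assumes subalg: "subalgebra M F"
    and d_measurable [measurable]: "d \<in> borel_measurable M"
    and d_moment: "integrable M (\<lambda>\<omega>. norm (d \<omega>) ^ 4)"
    and d_mean: "\<And>a. (\<integral>\<omega>. d \<omega> $ a \<partial>M) = 0"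
    and d_indep: "indep_set (sets F) (sets (vimage_algebra (space M) d borel))"
begin

sublocale finite_measure_subalgebra M F
  using subalg by unfold_locales

lemma measurable_F [measurable_dest]: "f \<in> measurable F N \<Longrightarrow> f \<in> measurable M N"
  using measurable_from_subalg[OF subalg] .

text \<open>\<open>\<phi> (d \<omega>)\<close> is measurable for the sigma-algebra generated by
  \<open>d\<close>, hence independent of \<open>f\<close>. Independence also yields integrability of
  the product from that of the two factors; this is how products of two entries of \<open>g\<close>
  with two of \<open>d\<close> become integrable when \<open>g\<close> is only square
  integrable.\<close>

lemma
  fixes f :: "'a \<Rightarrow> real"
  assumes f: "f \<in> borel_measurable F" and f_int: "integrable M f"
    and \<phi>: "\<phi> \<in> borel_measurable borel" and \<phi>_int: "integrable M (\<lambda>\<omega>. \<phi> (d \<omega>))"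
  shows integrable_mult_noise: "integrable M (\<lambda>\<omega>. f \<omega> * \<phi> (d \<omega>))"
    and integral_mult_noise: "(\<integral>\<omega>. f \<omega> * \<phi> (d \<omega>) \<partial>M) = (\<integral>\<omega>. f \<omega> \<partial>M) * (\<integral>\<omega>. \<phi> (d \<omega>) \<partial>M)"
proof -
  let ?G = "vimage_algebra (space M) d borel"
  have "subalgebra M ?G"
    by (simp add: subalgebra_def sets_image_in_sets)
  moreover have "d \<in> measurable ?G borel"
    by (intro measurable_vimage_algebra1) auto
  then have "(\<lambda>\<omega>. \<phi> (d \<omega>)) \<in> borel_measurable ?G"
    using \<phi> by (rule measurable_compose)
  ultimately have "indep_var borel f borel (\<lambda>\<omega>. \<phi> (d \<omega>))"
    using f d_indep subalg by (intro indep_set_imp_indep_var)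
  then show "integrable M (\<lambda>\<omega>. f \<omega> * \<phi> (d \<omega>))"
    "(\<integral>\<omega>. f \<omega> * \<phi> (d \<omega>) \<partial>M) = (\<integral>\<omega>. f \<omega> \<partial>M) * (\<integral>\<omega>. \<phi> (d \<omega>) \<partial>M)"
    using f_int \<phi>_int by (auto intro: indep_var_integrable indep_var_lebesgue_integral)
qed

text \<open>One growth criterion serves all noise polynomials: degrees 1 and 2 for mean and
  covariance, 3 for gamma, 4 for delta.\<close>

lemma integrable_noise:
  fixes \<phi> :: "real^'n \<Rightarrow> real"
  assumes [measurable]: "\<phi> \<in> borel_measurable borel"
    and bound: "\<And>y. \<bar>\<phi> y\<bar> \<le> C * norm y ^ j" and j: "j \<le> 4"
  shows "integrable M (\<lambda>\<omega>. \<phi> (d \<omega>))"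
proof (rule Bochner_Integration.integrable_bound)
  show "integrable M (\<lambda>\<omega>. \<bar>C\<bar> * (1 + norm (d \<omega>) ^ 4))"
    using d_moment by simp
  have "\<bar>\<phi> y\<bar> \<le> \<bar>C\<bar> * (1 + norm y ^ 4)" for y
  proof -
    have "\<bar>\<phi> y\<bar> \<le> C * norm y ^ j" by (rule bound)
    also have "\<dots> \<le> \<bar>C\<bar> * norm y ^ j" by (simp add: mult_right_mono)
    also have "\<dots> \<le> \<bar>C\<bar> * (1 + norm y ^ 4)" by (simp add: mult_left_mono norm_le_one_plus_pow4 j)
    finally show ?thesis .
  qed
  then show "AE \<omega> in M. norm (\<phi> (d \<omega>)) \<le> norm (\<bar>C\<bar> * (1 + norm (d \<omega>) ^ 4))"
    by (simp add: abs_mult)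
qed measurable

lemma integrable_d: "integrable M (\<lambda>\<omega>. d \<omega> $ a)"
  by (rule integrable_noise[where \<phi>="\<lambda>y. y $ a" and C=1 and j=1]) (auto simp: component_le_norm_cart)

lemma integrable_dd: "integrable M (\<lambda>\<omega>. d \<omega> $ a * d \<omega> $ b)"
  by (rule integrable_noise[where \<phi>="\<lambda>y. y $ a * y $ b" and C=1 and j=2])
    (auto simp: abs_mult power2_eq_square intro!: mult_mono component_le_norm_cart)

lemma quad_bound: "\<bar>y \<bullet> (R *v y)\<bar> \<le> onorm ((*v) R) * norm y ^ 2" for R :: "real^'n^'n"
proof -
  have "\<bar>y \<bullet> (R *v y)\<bar> \<le> norm y * norm (R *v y)"
    by (rule Cauchy_Schwarz_ineq2)
  also have "\<dots> \<le> norm y * (onorm ((*v) R) * norm y)"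
    by (intro mult_left_mono onorm) auto
  finally show ?thesis
    by (simp add: power2_eq_square mult_ac)
qed

lemma integrable_quad: "integrable M (\<lambda>\<omega>. d \<omega> \<bullet> (R *v d \<omega>))"
  by (rule integrable_noise[where \<phi>="\<lambda>y. y \<bullet> (R *v y)" and j=2, OF _ quad_bound])
    (auto simp: inner_vec_def matrix_vector_mult_def)

lemma integrable_quad_d: "integrable M (\<lambda>\<omega>. (d \<omega> \<bullet> (R *v d \<omega>)) * d \<omega> $ a)"
proof (rule integrable_noise[where \<phi>="\<lambda>y. (y \<bullet> (R *v y)) * y $ a" and j=3])
  show "\<bar>(y \<bullet> (R *v y)) * y $ a\<bar> \<le> onorm ((*v) R) * norm y ^ 3" for y
  proof -
    have "\<bar>(y \<bullet> (R *v y)) * y $ a\<bar> \<le> (onorm ((*v) R) * norm y ^ 2) * norm y"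
      unfolding abs_mult by (intro mult_mono quad_bound component_le_norm_cart) (auto simp: onorm_pos_le)
    then show ?thesis
      by (simp add: power2_eq_square power3_eq_cube mult_ac)
  qed
qed (auto simp: inner_vec_def matrix_vector_mult_def)

lemma integrable_quad_quad: "integrable M (\<lambda>\<omega>. (d \<omega> \<bullet> (R *v d \<omega>))\<^sup>2)"
proof (rule integrable_noise[where \<phi>="\<lambda>y. (y \<bullet> (R *v y))\<^sup>2" and j=4])
  show "\<bar>(y \<bullet> (R *v y))\<^sup>2\<bar> \<le> (onorm ((*v) R))\<^sup>2 * norm y ^ 4" for y
  proof -
    have "\<bar>y \<bullet> (R *v y)\<bar> ^ 2 \<le> (onorm ((*v) R) * norm y ^ 2) ^ 2"
      by (intro power_mono quad_bound) auto
    then show ?thesis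
      by (simp add: power_mult_distrib flip: power_mult)
  qed
qed (auto simp: inner_vec_def matrix_vector_mult_def)

text \<open>Since \<open>d\<close> has mean zero, these second moments are the entries of
  Sigma.\<close>

definition S :: "'n \<Rightarrow> 'n \<Rightarrow> real" where
  "S a b = (\<integral>\<omega>. d \<omega> $ a * d \<omega> $ b \<partial>M)"

lemma S_sym: "S a b = S b a"
  by (simp add: S_def mult.commute)

section \<open>Quadratic costs with \<open>F\<close>-measurable coefficients: innovation and second
  moments\<close>

context
  fixes g :: "'n \<Rightarrow> 'a \<Rightarrow> real"
  assumes g[measurable]: "\<And>a. g a \<in> borel_measurable F"
    and g_sq: "\<And>a. integrable M (\<lambda>\<omega>. (g a \<omega>)\<^sup>2)"
begin

lemma
  shows integrable_g: "integrable M (g a)"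
    and integrable_gg: "integrable M (\<lambda>\<omega>. g a \<omega> * g b \<omega>)"
    and integrable_gd: "integrable M (\<lambda>\<omega>. g a \<omega> * d \<omega> $ b)"
    and integral_gd: "(\<integral>\<omega>. g a \<omega> * d \<omega> $ b \<partial>M) = 0"
proof -
  show gi: "integrable M (g a)"
    by (rule square_integrable_imp_integrable) (use g_sq in auto)
  show "integrable M (\<lambda>\<omega>. g a \<omega> * g b \<omega>)"
    by (rule integrable_mult_of_squares) (use g_sq in auto)
  show "integrable M (\<lambda>\<omega>. g a \<omega> * d \<omega> $ b)"
    using integrable_mult_noise[OF g gi, where \<phi>="\<lambda>y. y $ b"] integrable_d by auto
  show "(\<integral>\<omega>. g a \<omega> * d \<omega> $ b \<partial>M) = 0"
    using integral_mult_noise[OF g gi, where \<phi>="\<lambda>y. y $ b"] integrable_d d_mean by auto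
qed

text \<open>\<open>c\<close> is already \<open>F\<close>-measurable, the linear term has conditional
  mean zero, and the quadratic term is independent of \<open>F\<close>, so it contributes its
  expectation.\<close>

lemma cond_exp_quadratic:
  assumes c: "c \<in> borel_measurable F" and c_int: "integrable M c"
    and z: "\<And>\<omega>. \<omega> \<in> space M \<Longrightarrow>
      z \<omega> = c \<omega> + 2 * (\<Sum>a\<in>UNIV. d \<omega> $ a * g a \<omega>) + d \<omega> \<bullet> (R *v d \<omega>)"
  shows "AE \<omega> in M. real_cond_exp M F z \<omega> = c \<omega> + (\<integral>\<omega>. d \<omega> \<bullet> (R *v d \<omega>) \<partial>M)"
proof (rule real_cond_exp_charact)
  let ?q = "\<lambda>\<omega>. d \<omega> \<bullet> (R *v d \<omega>)"
  let ?z = "\<lambda>\<omega>. c \<omega> + 2 * (\<Sum>a\<in>UNIV. g a \<omega> * d \<omega> $ a) + ?q \<omega>"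
  have z_int: "integrable M ?z"
    using c_int integrable_gd integrable_quad by auto
  then show "integrable M z"
    by (subst Bochner_Integration.integrable_cong[where g="?z"]) (auto simp: z mult.commute)
  show "integrable M (\<lambda>\<omega>. c \<omega> + (\<integral>\<omega>. ?q \<omega> \<partial>M))"
    using c_int by simp
  show "(\<lambda>\<omega>. c \<omega> + (\<integral>\<omega>. ?q \<omega> \<partial>M)) \<in> borel_measurable F"
    using c by measurable
  fix E assume E: "E \<in> sets F"
  let ?i = "indicator E :: 'a \<Rightarrow> real"
  have i: "?i \<in> borel_measurable F"
    using E by measurable
  have EM: "E \<in> sets M"
    using E subalg by (auto simp: subalgebra_def)
  then have i_int: "integrable M ?i"
    by (simp add: less_top[symmetric])
  have ic: "integrable M (\<lambda>\<omega>. ?i \<omega> * c \<omega>)"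
    using integrable_mult_indicator[OF EM c_int] by simp
  \<comment> \<open>The indicator of \<open>E\<close> joins the \<open>F\<close>-measurable factor
    \<open>g a\<close>, so independence and centring annihilate the linear term over
    \<open>E\<close> as well.\<close>
  have ig: "(\<lambda>\<omega>. ?i \<omega> * g a \<omega>) \<in> borel_measurable F" for a
    using i g by measurable
  have igd: "integrable M (\<lambda>\<omega>. (?i \<omega> * g a \<omega>) * d \<omega> $ a)"
    "(\<integral>\<omega>. (?i \<omega> * g a \<omega>) * d \<omega> $ a \<partial>M) = 0" for a
  proof -
    have "integrable M (\<lambda>\<omega>. ?i \<omega> * g a \<omega>)"
      using integrable_mult_indicator[OF EM integrable_g] by simp
    then show "integrable M (\<lambda>\<omega>. (?i \<omega> * g a \<omega>) * d \<omega> $ a)"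
      "(\<integral>\<omega>. (?i \<omega> * g a \<omega>) * d \<omega> $ a \<partial>M) = 0"
      using integrable_mult_noise[OF ig, where \<phi>="\<lambda>y. y $ a"]
        integral_mult_noise[OF ig, where \<phi>="\<lambda>y. y $ a"] integrable_d d_mean by auto
  qed
  have qm: "(\<lambda>y. y \<bullet> (R *v y)) \<in> borel_measurable borel"
    by (simp add: inner_vec_def matrix_vector_mult_def)
  have "(\<integral>\<omega>\<in>E. z \<omega> \<partial>M)
      = (\<integral>\<omega>. ?i \<omega> * c \<omega> + 2 * (\<Sum>a\<in>UNIV. (?i \<omega> * g a \<omega>) * d \<omega> $ a) + ?i \<omega> * ?q \<omega> \<partial>M)"
    unfolding set_lebesgue_integral_def
    by (intro Bochner_Integration.integral_cong) (auto simp: z sum_distrib_left algebra_simps)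
  also have "\<dots> = (\<integral>\<omega>. ?i \<omega> * c \<omega> \<partial>M) + (\<integral>\<omega>. ?i \<omega> * ?q \<omega> \<partial>M)"
    using ic igd
      integrable_mult_noise[OF i i_int qm integrable_quad]
    by (simp add: Bochner_Integration.integral_sum)
  also have "\<dots> = (\<integral>\<omega>. ?i \<omega> * c \<omega> \<partial>M) + (\<integral>\<omega>. ?i \<omega> * (\<integral>\<omega>. ?q \<omega> \<partial>M) \<partial>M)"
    using integral_mult_noise[OF i i_int qm integrable_quad] by simp
  also have "\<dots> = (\<integral>\<omega>\<in>E. c \<omega> + (\<integral>\<omega>. ?q \<omega> \<partial>M) \<partial>M)"
    unfolding set_lebesgue_integral_def real_scaleR_def distrib_left
    by (rule Bochner_Integration.integral_add[OF ic integrable_mult_left, symmetric]) (use i_int in simp)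
  finally show "(\<integral>\<omega>\<in>E. z \<omega> \<partial>M) = (\<integral>\<omega>\<in>E. c \<omega> + (\<integral>\<omega>. ?q \<omega> \<partial>M) \<partial>M)" .
qed

text \<open>The innovation is 2 s + (q - \<tau>) with s = g . d and \<tau> = E q. In its square,
  independence turns E(s^2) into \<open>S\<close> paired with E(g g^T), and the cross term into E(q
  d) paired with E g; the last term is the variance of q.\<close>

lemma
  assumes c: "c \<in> borel_measurable F" and c_int: "integrable M c"
    and z: "\<And>\<omega>. \<omega> \<in> space M \<Longrightarrow>
      z \<omega> = c \<omega> + 2 * (\<Sum>a\<in>UNIV. d \<omega> $ a * g a \<omega>) + d \<omega> \<bullet> (R *v d \<omega>)"
    and zm [measurable]: "z \<in> borel_measurable M"
  defines "q \<equiv> \<lambda>\<omega>. d \<omega> \<bullet> (R *v d \<omega>)"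
  shows integrable_innovation_square: "integrable M (\<lambda>\<omega>. (z \<omega> - real_cond_exp M F z \<omega>)\<^sup>2)"
    and integral_innovation_square: "(\<integral>\<omega>. (z \<omega> - real_cond_exp M F z \<omega>)\<^sup>2 \<partial>M)
      = 4 * (\<Sum>a\<in>UNIV. \<Sum>b\<in>UNIV. S a b * (\<integral>\<omega>. g a \<omega> * g b \<omega> \<partial>M))
        + 4 * (\<Sum>a\<in>UNIV. (\<integral>\<omega>. q \<omega> * d \<omega> $ a \<partial>M) * (\<integral>\<omega>. g a \<omega> \<partial>M))
        + (\<integral>\<omega>. (q \<omega> - (\<integral>\<xi>. q \<xi> \<partial>M))\<^sup>2 \<partial>M)"
proof -
  define \<tau> where "\<tau> = (\<integral>\<omega>. q \<omega> \<partial>M)"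
  let ?D = "\<lambda>\<omega>. 4 * (\<Sum>a\<in>UNIV. \<Sum>b\<in>UNIV. (g a \<omega> * g b \<omega>) * (d \<omega> $ a * d \<omega> $ b))
     + 4 * (\<Sum>a\<in>UNIV. g a \<omega> * ((q \<omega> - \<tau>) * d \<omega> $ a)) + (q \<omega> - \<tau>)\<^sup>2"
  note [measurable] = measurable_F[OF g]
  have [measurable]: "q \<in> borel_measurable M"
    unfolding q_def by (rule borel_measurable_integrable[OF integrable_quad])
  have "(z \<omega> - real_cond_exp M F z \<omega>)\<^sup>2 = ?D \<omega>"
    if "real_cond_exp M F z \<omega> = c \<omega> + \<tau>" "\<omega> \<in> space M" for \<omega>
  proof -
    let ?s = "\<Sum>a\<in>UNIV. d \<omega> $ a * g a \<omega>"
    have "z \<omega> - real_cond_exp M F z \<omega> = 2 * ?s + (q \<omega> - \<tau>)"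
      using that z by (simp add: q_def)
    moreover have "(2 * s + r)\<^sup>2 = 4 * (s * s) + 4 * (s * r) + r\<^sup>2" for s r :: real
      by (simp add: power2_eq_square algebra_simps)
    moreover have "?s * ?s = (\<Sum>a\<in>UNIV. \<Sum>b\<in>UNIV. (g a \<omega> * g b \<omega>) * (d \<omega> $ a * d \<omega> $ b))"
      unfolding sum_product by (simp only: mult_ac)
    moreover have "?s * (q \<omega> - \<tau>) = (\<Sum>a\<in>UNIV. g a \<omega> * ((q \<omega> - \<tau>) * d \<omega> $ a))"
      unfolding sum_distrib_right by (simp only: mult_ac)
    ultimately show ?thesis
      by (simp only:)
  qed
  \<comment> \<open>The conditional expectation is known only up to a null set, so the square equals
    \<open>?D\<close> almost everywhere.\<close>
  then have AE_D: "AE \<omega> in M. (z \<omega> - real_cond_exp M F z \<omega>)\<^sup>2 = ?D \<omega>"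
    using cond_exp_quadratic[OF c c_int z] unfolding \<tau>_def q_def by auto
  have q_int: "integrable M q"
    unfolding q_def by (rule integrable_quad)
  have "integrable M (\<lambda>\<omega>. (q \<omega>)\<^sup>2)"
    unfolding q_def by (rule integrable_quad_quad)
  then have v_int: "integrable M (\<lambda>\<omega>. (q \<omega> - \<tau>)\<^sup>2)"
    using q_int by (simp add: power2_diff)
  have qd_eq: "(q \<omega> - \<tau>) * d \<omega> $ a = q \<omega> * d \<omega> $ a - \<tau> * d \<omega> $ a" for \<omega> a
    by (rule left_diff_distrib)
  have qd_int: "integrable M (\<lambda>\<omega>. (q \<omega> - \<tau>) * d \<omega> $ a)" for a
    unfolding qd_eq using integrable_quad_d integrable_d by (simp add: q_def)
  \<comment> \<open>Centring \<open>q\<close> leaves this moment unchanged, because \<tau>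
    multiplies a component of mean zero.\<close>
  have qd: "(\<integral>\<omega>. (q \<omega> - \<tau>) * d \<omega> $ a \<partial>M) = (\<integral>\<omega>. q \<omega> * d \<omega> $ a \<partial>M)" for a
    unfolding qd_eq using integrable_quad_d integrable_d by (simp add: q_def d_mean)
  have gg: "(\<lambda>\<omega>. g a \<omega> * g b \<omega>) \<in> borel_measurable F" for a b
    using g by measurable
  have ggdd: "integrable M (\<lambda>\<omega>. (g a \<omega> * g b \<omega>) * (d \<omega> $ a * d \<omega> $ b))"
    "(\<integral>\<omega>. (g a \<omega> * g b \<omega>) * (d \<omega> $ a * d \<omega> $ b) \<partial>M) = S a b * (\<integral>\<omega>. g a \<omega> * g b \<omega> \<partial>M)" for a b
    using integrable_mult_noise[OF gg integrable_gg, where \<phi>="\<lambda>y. y $ a * y $ b"]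
      integral_mult_noise[OF gg integrable_gg, where \<phi>="\<lambda>y. y $ a * y $ b"] integrable_dd
    by (auto simp: S_def)
  have gqd: "integrable M (\<lambda>\<omega>. g a \<omega> * ((q \<omega> - \<tau>) * d \<omega> $ a))"
    "(\<integral>\<omega>. g a \<omega> * ((q \<omega> - \<tau>) * d \<omega> $ a) \<partial>M) = (\<integral>\<omega>. q \<omega> * d \<omega> $ a \<partial>M) * (\<integral>\<omega>. g a \<omega> \<partial>M)" for a
  proof -
    have m: "(\<lambda>y. (y \<bullet> (R *v y) - \<tau>) * y $ a) \<in> borel_measurable borel"
      by (simp add: inner_vec_def matrix_vector_mult_def)
    show "integrable M (\<lambda>\<omega>. g a \<omega> * ((q \<omega> - \<tau>) * d \<omega> $ a))"
      using integrable_mult_noise[OF g integrable_g m] qd_int by (simp add: q_def)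
    show "(\<integral>\<omega>. g a \<omega> * ((q \<omega> - \<tau>) * d \<omega> $ a) \<partial>M) = (\<integral>\<omega>. q \<omega> * d \<omega> $ a \<partial>M) * (\<integral>\<omega>. g a \<omega> \<partial>M)"
      using integral_mult_noise[OF g integrable_g m] qd_int qd
      by (simp add: q_def)
  qed
  have D_int: "integrable M ?D"
    using ggdd gqd v_int by auto
  have res_m: "(\<lambda>\<omega>. (z \<omega> - real_cond_exp M F z \<omega>)\<^sup>2) \<in> borel_measurable M"
    using measurable_F[OF borel_measurable_cond_exp] by measurable
  show "integrable M (\<lambda>\<omega>. (z \<omega> - real_cond_exp M F z \<omega>)\<^sup>2)"
    by (rule iffD2[OF integrable_cong_AE[OF res_m borel_measurable_integrable[OF D_int] AE_D] D_int])
  have "(\<integral>\<omega>. (z \<omega> - real_cond_exp M F z \<omega>)\<^sup>2 \<partial>M) = (\<integral>\<omega>. ?D \<omega> \<partial>M)"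
    by (rule integral_cong_AE[OF res_m borel_measurable_integrable[OF D_int] AE_D])
  also have "\<dots> = 4 * (\<Sum>a\<in>UNIV. \<Sum>b\<in>UNIV. S a b * (\<integral>\<omega>. g a \<omega> * g b \<omega> \<partial>M))
        + 4 * (\<Sum>a\<in>UNIV. (\<integral>\<omega>. q \<omega> * d \<omega> $ a \<partial>M) * (\<integral>\<omega>. g a \<omega> \<partial>M))
        + (\<integral>\<omega>. (q \<omega> - \<tau>)\<^sup>2 \<partial>M)"
    using ggdd gqd v_int by (simp add: Bochner_Integration.integral_sum)
  finally show "(\<integral>\<omega>. (z \<omega> - real_cond_exp M F z \<omega>)\<^sup>2 \<partial>M)
      = 4 * (\<Sum>a\<in>UNIV. \<Sum>b\<in>UNIV. S a b * (\<integral>\<omega>. g a \<omega> * g b \<omega> \<partial>M))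
        + 4 * (\<Sum>a\<in>UNIV. (\<integral>\<omega>. q \<omega> * d \<omega> $ a \<partial>M) * (\<integral>\<omega>. g a \<omega> \<partial>M))
        + (\<integral>\<omega>. (q \<omega> - (\<integral>\<xi>. q \<xi> \<partial>M))\<^sup>2 \<partial>M)"
    by (simp add: \<tau>_def)
qed

text \<open>The shift \<open>R d\<close> has mean zero and is uncorrelated with \<open>g\<close>, so
  it adds only \<open>S\<close> paired entrywise with the covariance R S R^T of \<open>R d\<close>.
  Here \<open>R\<close> need not be symmetric, hence the transpose in the trace.\<close>

lemma
  fixes R :: "real^'n^'n" and \<gamma> :: "'n \<Rightarrow> real"
  defines "G \<equiv> \<lambda>a \<omega>. g a \<omega> + (R *v d \<omega>) $ a"
  defines "rhs \<equiv> \<lambda>\<omega>. 4 * (\<Sum>a\<in>UNIV. \<Sum>b\<in>UNIV. S a b * (G a \<omega> * G b \<omega>)) + 4 * (\<Sum>a\<in>UNIV. \<gamma> a * G a \<omega>)"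
  shows integrable_quad_shifted: "integrable M rhs"
    and integral_quad_shifted: "(\<integral>\<omega>. rhs \<omega> \<partial>M)
      = 4 * (\<Sum>a\<in>UNIV. \<Sum>b\<in>UNIV. S a b * (\<integral>\<omega>. g a \<omega> * g b \<omega> \<partial>M))
        + 4 * (\<Sum>a\<in>UNIV. \<gamma> a * (\<integral>\<omega>. g a \<omega> \<partial>M))
        + 4 * trace ((\<chi> a b. S a b) ** transpose R ** ((\<chi> a b. S a b) ** R))"
proof -
  have R: "(R *v d \<omega>) $ a = (\<Sum>c\<in>UNIV. R $ a $ c * d \<omega> $ c)" for \<omega> a
    by (simp add: matrix_vector_mult_def)
  have R_int: "integrable M (\<lambda>\<omega>. (R *v d \<omega>) $ a)" "(\<integral>\<omega>. (R *v d \<omega>) $ a \<partial>M) = 0" for a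
    unfolding R using integrable_d by (auto simp: d_mean Bochner_Integration.integral_sum)
  have gR_int: "integrable M (\<lambda>\<omega>. g a \<omega> * (R *v d \<omega>) $ b)"
    "(\<integral>\<omega>. g a \<omega> * (R *v d \<omega>) $ b \<partial>M) = 0" for a b
  proof -
    have "g a \<omega> * (R *v d \<omega>) $ b = (\<Sum>c\<in>UNIV. R $ b $ c * (g a \<omega> * d \<omega> $ c))" for \<omega>
      by (simp add: R sum_distrib_left mult_ac)
    then show "integrable M (\<lambda>\<omega>. g a \<omega> * (R *v d \<omega>) $ b)"
      "(\<integral>\<omega>. g a \<omega> * (R *v d \<omega>) $ b \<partial>M) = 0"
      using integrable_gd integral_gd
      by (auto simp: Bochner_Integration.integral_sum)
  qed
  have RR_int: "integrable M (\<lambda>\<omega>. (R *v d \<omega>) $ a * (R *v d \<omega>) $ b)"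
    "(\<integral>\<omega>. (R *v d \<omega>) $ a * (R *v d \<omega>) $ b \<partial>M)
      = (\<Sum>c\<in>UNIV. \<Sum>e\<in>UNIV. R $ a $ c * R $ b $ e * S c e)" for a b
  proof -
    have "(R *v d \<omega>) $ a * (R *v d \<omega>) $ b
        = (\<Sum>c\<in>UNIV. \<Sum>e\<in>UNIV. R $ a $ c * R $ b $ e * (d \<omega> $ c * d \<omega> $ e))" for \<omega>
      by (simp add: R sum_product mult_ac)
    then show "integrable M (\<lambda>\<omega>. (R *v d \<omega>) $ a * (R *v d \<omega>) $ b)"
      "(\<integral>\<omega>. (R *v d \<omega>) $ a * (R *v d \<omega>) $ b \<partial>M)
        = (\<Sum>c\<in>UNIV. \<Sum>e\<in>UNIV. R $ a $ c * R $ b $ e * S c e)"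
      using integrable_dd by (auto simp: S_def Bochner_Integration.integral_sum)
  qed
  have G_int: "integrable M (G a)" "(\<integral>\<omega>. G a \<omega> \<partial>M) = (\<integral>\<omega>. g a \<omega> \<partial>M)" for a
    unfolding G_def using integrable_g R_int by auto
  have GG: "G a \<omega> * G b \<omega> = g a \<omega> * g b \<omega> + g a \<omega> * (R *v d \<omega>) $ b
      + g b \<omega> * (R *v d \<omega>) $ a + (R *v d \<omega>) $ a * (R *v d \<omega>) $ b" for a b \<omega>
    unfolding G_def by (simp add: algebra_simps)
  have GG_int: "integrable M (\<lambda>\<omega>. G a \<omega> * G b \<omega>)"
    "(\<integral>\<omega>. G a \<omega> * G b \<omega> \<partial>M) = (\<integral>\<omega>. g a \<omega> * g b \<omega> \<partial>M)
      + (\<Sum>c\<in>UNIV. \<Sum>e\<in>UNIV. R $ a $ c * R $ b $ e * S c e)" for a b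
    unfolding GG using integrable_gg gR_int RR_int by auto
  show "integrable M rhs"
    unfolding rhs_def using G_int GG_int by auto
  \<comment> \<open>Symmetry of \<open>S\<close> identifies the trace with the entrywise pairing of
    \<open>S\<close> and R S R^T.\<close>
  have "trace ((\<chi> a b. S a b) ** transpose R ** ((\<chi> a b. S a b) ** R))
      = (\<Sum>a\<in>UNIV. \<Sum>b\<in>UNIV. (\<Sum>e\<in>UNIV. S a e * R $ b $ e) * (\<Sum>c\<in>UNIV. S c b * R $ c $ a))"
    by (simp add: trace_def matrix_matrix_mult_def transpose_def S_sym)
  also have "\<dots> = (\<Sum>c\<in>UNIV. \<Sum>b\<in>UNIV. \<Sum>a\<in>UNIV. \<Sum>e\<in>UNIV. S c b * (R $ c $ a * R $ b $ e * S a e))"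
    unfolding sum_product by (subst sum_swap4) (simp only: mult_ac)
  also have "\<dots> = (\<Sum>a\<in>UNIV. \<Sum>b\<in>UNIV. S a b * (\<Sum>c\<in>UNIV. \<Sum>e\<in>UNIV. R $ a $ c * R $ b $ e * S c e))"
    by (simp only: sum_distrib_left)
  finally have tr: "trace ((\<chi> a b. S a b) ** transpose R ** ((\<chi> a b. S a b) ** R))
      = (\<Sum>a\<in>UNIV. \<Sum>b\<in>UNIV. S a b * (\<Sum>c\<in>UNIV. \<Sum>e\<in>UNIV. R $ a $ c * R $ b $ e * S c e))" .
  have "(\<integral>\<omega>. rhs \<omega> \<partial>M) = 4 * (\<Sum>a\<in>UNIV. \<Sum>b\<in>UNIV. S a b * (\<integral>\<omega>. G a \<omega> * G b \<omega> \<partial>M))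
        + 4 * (\<Sum>a\<in>UNIV. \<gamma> a * (\<integral>\<omega>. g a \<omega> \<partial>M))"
    unfolding rhs_def using G_int GG_int(1) by (simp add: Bochner_Integration.integral_sum)
  then show "(\<integral>\<omega>. rhs \<omega> \<partial>M)
      = 4 * (\<Sum>a\<in>UNIV. \<Sum>b\<in>UNIV. S a b * (\<integral>\<omega>. g a \<omega> * g b \<omega> \<partial>M))
        + 4 * (\<Sum>a\<in>UNIV. \<gamma> a * (\<integral>\<omega>. g a \<omega> \<partial>M))
        + 4 * trace ((\<chi> a b. S a b) ** transpose R ** ((\<chi> a b. S a b) ** R))"
    unfolding tr GG_int(2) distrib_left sum.distrib by simp
qed

end

text \<open>The form is the second moment of the scalar h . d.\<close>

lemma S_psd: "0 \<le> (\<Sum>a\<in>UNIV. \<Sum>b\<in>UNIV. S a b * (h a * h b))"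
proof -
  have "(\<Sum>a\<in>UNIV. \<Sum>b\<in>UNIV. S a b * (h a * h b)) = (\<integral>\<omega>. (\<Sum>a\<in>UNIV. h a * d \<omega> $ a)\<^sup>2 \<partial>M)"
  proof -
    have "(\<Sum>a\<in>UNIV. h a * d \<omega> $ a)\<^sup>2 = (\<Sum>a\<in>UNIV. \<Sum>b\<in>UNIV. h a * h b * (d \<omega> $ a * d \<omega> $ b))" for \<omega>
      by (simp add: power2_eq_square sum_product mult_ac)
    then show ?thesis
      using integrable_dd by (simp add: S_def Bochner_Integration.integral_sum mult.commute)
  qed
  then show ?thesis
    by simp
qed

end

section \<open>Invariance of the noise statistics under equality of laws\<close>

lemma integral_cong_distr:
  fixes \<phi> :: "'b::topological_space \<Rightarrow> 'c::{banach, second_countable_topology}"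
  assumes "distr M borel v = distr M borel v'" "v \<in> borel_measurable M" "v' \<in> borel_measurable M"
    and "\<phi> \<in> borel_measurable borel"
  shows "(\<integral>\<omega>. \<phi> (v \<omega>) \<partial>M) = (\<integral>\<omega>. \<phi> (v' \<omega>) \<partial>M)"
  using integral_distr[OF assms(2,4)] integral_distr[OF assms(3,4)] assms(1) by simp

text \<open>The mean depends on the law only. Once both means are the same constant, each statistic
  integrates a fixed continuous function of the noise. This links \<open>w 0\<close>, used in the
  theorem, to the noise of the step considered.\<close>

lemma
  fixes v v' :: "'a \<Rightarrow> real^'n::finite"
  assumes "distr M borel v = distr M borel v'" "v \<in> borel_measurable M" "v' \<in> borel_measurable M"
  shows noise_Sigma_cong_distr: "noise_Sigma M v = noise_Sigma M v'"
    and noise_gamma_cong_distr: "noise_gamma M R v = noise_gamma M R v'"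
    and noise_delta_cong_distr: "noise_delta M R v = noise_delta M R v'"
proof -
  note eq = integral_cong_distr[OF assms]
  have mean: "integral\<^sup>L M v = integral\<^sup>L M v'"
    using eq[of "\<lambda>y. y"] by simp
  have cont: "continuous_on UNIV (\<lambda>y. (y - m) \<bullet> (R *v (y - m)))" for m
    by (intro continuous_intros matrix_vector_mult_linear_continuous_on[THEN continuous_on_compose2]) auto
  show "noise_Sigma M v = noise_Sigma M v'"
    unfolding noise_Sigma_def centered_def mean
    by (rule eq, intro borel_measurable_continuous_onI continuous_intros)
  show "noise_gamma M R v = noise_gamma M R v'"
    unfolding noise_gamma_def centered_def mean
    by (rule eq, intro borel_measurable_continuous_onI continuous_intros cont)
  have "(\<integral>\<omega>. (v \<omega> - m) \<bullet> (R *v (v \<omega> - m)) \<partial>M) = (\<integral>\<omega>. (v' \<omega> - m) \<bullet> (R *v (v' \<omega> - m)) \<partial>M)" for m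
    by (rule eq, intro borel_measurable_continuous_onI cont)
  then show "noise_delta M R v = noise_delta M R v'"
    unfolding noise_delta_def centered_def mean Let_def
    by (simp only:, intro eq borel_measurable_continuous_onI continuous_intros cont)
qed

section \<open>History sigma-algebras and centring of independent noise\<close>

lemma sets_hist_algebra_subset:
  assumes "space N = space M"
    and "\<And>s. s \<le> t \<Longrightarrow> x s \<in> borel_measurable N" "\<And>s. s < t \<Longrightarrow> u s \<in> borel_measurable N"
  shows "sets (hist_algebra M x u t) \<subseteq> sets N"
  unfolding hist_algebra_def using assms
  by (intro sets_image_in_sets measurable_Pair measurable_restrict) auto

lemma space_hist_algebra [simp]: "space (hist_algebra M x u t) = space M"
  by (simp add: hist_algebra_def)

lemma hist_algebra_state_measurable:
  assumes "s \<le> t"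
  shows "x s \<in> borel_measurable (hist_algebra M x u t)"
proof -
  let ?P = "PiM {..t} (\<lambda>_. borel) \<Otimes>\<^sub>M PiM {..<t} (\<lambda>_. borel)"
  have "(\<lambda>\<omega>. (\<lambda>s\<in>{..t}. x s \<omega>, \<lambda>s\<in>{..<t}. u s \<omega>)) \<in> measurable (hist_algebra M x u t) ?P"
    unfolding hist_algebra_def
    by (intro measurable_vimage_algebra1) (auto simp: space_pair_measure space_PiM)
  moreover have "(\<lambda>p. fst p s) \<in> measurable ?P borel"
    using assms by (intro measurable_compose[OF measurable_fst measurable_component_singleton]) simp
  ultimately have "(\<lambda>\<omega>. fst (\<lambda>s\<in>{..t}. x s \<omega>, \<lambda>s\<in>{..<t}. u s \<omega>) s) \<in> borel_measurable (hist_algebra M x u t)"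
    by (rule measurable_compose)
  then show ?thesis
    using assms by simp
qed

lemma measurable_matrix_vector [measurable]:
  fixes A :: "real^'m::finite^'n::finite"
  shows "(\<lambda>v. A *v v) \<in> borel_measurable borel"
  by (intro borel_measurable_continuous_onI linear_continuous_on) auto

text \<open>Centring preserves the fourth moment, and \<open>centered M v\<close> is a Borel
  function of \<open>v\<close>, so it generates no larger sigma-algebra and independence
  survives.\<close>

lemma (in prob_space) centered_independent_noise:
  fixes v :: "'a \<Rightarrow> real^'n::finite"
  assumes sub: "subalgebra M F" and v [measurable]: "v \<in> borel_measurable M"
    and mom: "integrable M (\<lambda>\<omega>. norm (v \<omega>) ^ 4)"
    and ind: "indep_set (sets F) (sets (vimage_algebra (space M) v borel))"
  shows "independent_noise M F (centered M v)"
proof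
  show [measurable]: "centered M v \<in> borel_measurable M"
    unfolding centered_def[abs_def] by measurable
  show "integrable M (\<lambda>\<omega>. norm (centered M v \<omega>) ^ 4)"
    unfolding centered_def by (rule integrable_norm_diff_pow4[OF v mom])
  \<comment> \<open>The fourth moment makes \<open>v\<close> integrable, so the constant subtracted
    is a true expectation and not the default value 0.\<close>
  have "integrable M (\<lambda>\<omega>. norm (v \<omega>))"
    using integrable_norm_pow_le4[OF v mom, of 1] by simp
  then have vi: "integrable M v"
    by (simp add: integrable_norm_iff)
  then have "integrable M (\<lambda>\<omega>. v \<omega> $ a)" for a
    by (rule integrable_bounded_linear[OF bounded_linear_vec_nth])
  then show "(\<integral>\<omega>. centered M v \<omega> $ a \<partial>M) = 0" for a
    by (simp add: centered_def integral_vec_nth prob_space)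
  have "v \<in> measurable (vimage_algebra (space M) v borel) borel"
    by (intro measurable_vimage_algebra1) auto
  then have "sets (vimage_algebra (space M) (centered M v) borel)
      \<subseteq> sets (vimage_algebra (space M) v borel)"
    unfolding centered_def[abs_def] by (intro sets_image_in_sets) auto
  then show "indep_set (sets F) (sets (vimage_algebra (space M) (centered M v) borel))"
    by (intro indep_set_mono[OF ind]) auto
qed (use sub in auto)

context independent_noise
begin

text \<open>The definitions use vector- and matrix-valued integrals; the moment bounds of the locale
  permit reading them off entry by entry.\<close>

lemma noise_statistics:
  assumes "d = centered M v"
  shows noise_Sigma_nth: "noise_Sigma M v $ a $ b = S a b"
    and noise_gamma_nth: "noise_gamma M R v $ a = (\<integral>\<omega>. (d \<omega> \<bullet> (R *v d \<omega>)) * d \<omega> $ a \<partial>M)"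
    and noise_delta_eq: "noise_delta M R v
      = (\<integral>\<omega>. (d \<omega> \<bullet> (R *v d \<omega>) - (\<integral>\<xi>. d \<xi> \<bullet> (R *v d \<xi>) \<partial>M))\<^sup>2 \<partial>M)"
  unfolding noise_Sigma_def noise_gamma_def noise_delta_def S_def assms[symmetric] Let_def
  using integrable_dd integrable_quad_d by (simp_all add: integral_mat_nth integral_vec_nth)

end

text \<open>The common law allows the statistics to be read off \<open>w 0\<close>. The
  integrability claims ensure that the equation does not rest on integrals with the default value
  0.\<close>

theorem lemma2:
  fixes M :: "'a measure"
    and N k :: nat
    and A :: "real^'n::finite^'n" and B :: "real^'m::finite^'n"
    and x w :: "nat \<Rightarrow> 'a \<Rightarrow> real^'n" and u :: "nat \<Rightarrow> 'a \<Rightarrow> real^'m"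
    and x0 :: "real^'n"
    and Q :: "'n block_mat"
  assumes prob: "prob_space M"
    and N: "1 \<le> N"
    and k: "k \<le> N"
    and Q: "Q \<in> sym_psd (block_idx k)"
    and x_rv: "\<forall>t\<le>N. x t \<in> borel_measurable M"
    and u_rv: "\<forall>t<N. u t \<in> borel_measurable M"
    and w_rv: "\<forall>t<N. w t \<in> borel_measurable M"
    and dynamics: "\<forall>t<N. \<forall>\<omega>\<in>space M. x (Suc t) \<omega> = A *v x t \<omega> + B *v u t \<omega> + w t \<omega>"
    and indep: "prob_space.indep_vars M (\<lambda>_. borel)
                  (\<lambda>i. case i of 0 \<Rightarrow> x 0 | Suc s \<Rightarrow> w s) {0..N}"
    and ident: "\<forall>s<N. \<forall>t<N. distr M borel (w s) = distr M borel (w t)"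
    and init: "AE \<omega> in M. x 0 \<omega> = x0"
    and A1: "\<forall>t<N. L2_vec M (hist_algebra M x u t) (u t)"
    and A2: "\<forall>t<N. integrable M (\<lambda>\<omega>. (norm (w t \<omega>)) ^ 4)"
  shows "\<forall>t\<in>{1..N}.
    (let I = block_idx (min k t); H = H_mat M Q (w 0); \<zeta> = zeta_vec M Q (w 0);
         rhs = (\<lambda>\<omega>. quad_form I H (eta x t \<omega>) + (\<Sum>p\<in>I. \<zeta> p * eta x t \<omega> p))
     in H \<in> sym_psd I
        \<and> integrable M (\<lambda>\<omega>. (Delta M k Q x u t \<omega>)\<^sup>2)
        \<and> integrable M rhs
        \<and> (\<integral>\<omega>. (Delta M k Q x u t \<omega>)\<^sup>2 \<partial>M)
            = (\<integral>\<omega>. rhs \<omega> \<partial>M) + noise_theta M (blk Q 0 0) (w 0))"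
proof
  fix t assume "t \<in> {1..N}"
  \<comment> \<open>The noise entering the state at time \<open>t\<close> is \<open>w s\<close> with
    s = t - 1, and \<open>Delta\<close> conditions on the history up to \<open>s\<close>.\<close>
  then obtain s where t: "t = Suc s" and sN: "s < N"
    by (cases t) auto
  interpret prob_space M by (rule prob)
  define K where "K = min k t"
  define F where "F = hist_algebra M x u s"
  define R where "R = blk Q 0 0"
  define d where "d = centered M (w s)"
  let ?I = "block_idx K :: (nat \<times> 'n) set"
  \<comment> \<open>\<open>K\<close> is at most \<open>k\<close>, so symmetry on the full index set
    restricts to the leading submatrix.\<close>
  have sym: "Q p q = Q q p" if "p \<in> ?I" "q \<in> ?I" for p q
    using Q that by (auto simp: sym_psd_def block_idx_def K_def)
  have R_sym: "transpose R = R"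
    using sym by (simp add: R_def blk_def transpose_def vec_eq_iff block_idx_def)
  have hist_M: "subalgebra M (hist_algebra M x u r)" if "r \<le> N" for r
    unfolding subalgebra_def using that x_rv u_rv by (intro conjI sets_hist_algebra_subset) auto
  have F_sub: "subalgebra M F"
    unfolding F_def using sN by (intro hist_M) auto

  \<comment> \<open>Independence of the history from the current noise\<close>
  have F_indep: "indep_set (sets F) (sets (vimage_algebra (space M) (w s) borel))"
  proof -
    \<comment> \<open>Index 0 carries the initial state and \<open>Suc r\<close> the noise
      \<open>w r\<close>. Thus \<open>{0..s}\<close> covers only the noise strictly before time
      \<open>s\<close>, while \<open>w s\<close> has index \<open>Suc s\<close>.\<close>
    let ?X = "\<lambda>i. case i of 0 \<Rightarrow> x 0 | Suc s \<Rightarrow> w s"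
    define W where "W J = vimage_algebra (space M) (\<lambda>\<omega>. \<lambda>i\<in>J. ?X i \<omega>) (PiM J (\<lambda>_. borel))" for J
    have space_W [simp]: "space (W J) = space M" for J
      by (simp add: W_def)
    have X: "?X i \<in> borel_measurable (W J)" if "i \<in> J" for i J
    proof -
      have "(\<lambda>\<omega>. \<lambda>i\<in>J. ?X i \<omega>) \<in> measurable (W J) (PiM J (\<lambda>_. borel))"
        unfolding W_def by (intro measurable_vimage_algebra1) (auto simp: space_PiM)
      from measurable_compose[OF this measurable_component_singleton[OF that]] that
      show ?thesis by simp
    qed
    \<comment> \<open>Closed-loop induction: the states up to \<open>r\<close> and the controls
      before \<open>r\<close> generate a history inside \<open>W {0..s}\<close>; \<open>A1\<close>
      places \<open>u r\<close> there, and the dynamics then place \<open>x (Suc r)\<close>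
      there.\<close>
    have "(\<forall>i\<le>r. x i \<in> borel_measurable (W {0..s})) \<and> (\<forall>i<r. u i \<in> borel_measurable (W {0..s}))"
      if "r \<le> s" for r
      using that
    proof (induction r)
      case 0
      then show ?case using X[of 0 "{0..s}"] by simp
    next
      case (Suc r)
      then have IH: "\<And>i. i \<le> r \<Longrightarrow> x i \<in> borel_measurable (W {0..s})"
        "\<And>i. i < r \<Longrightarrow> u i \<in> borel_measurable (W {0..s})"
        by auto
      have "subalgebra (W {0..s}) (hist_algebra M x u r)"
        unfolding subalgebra_def using IH by (intro conjI sets_hist_algebra_subset) auto
      moreover have "u r \<in> borel_measurable (hist_algebra M x u r)"
        using A1 Suc.prems sN by (simp add: L2_vec_def)
      ultimately have ur [measurable]: "u r \<in> borel_measurable (W {0..s})"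
        by (rule measurable_from_subalg)
      have [measurable]: "w r \<in> borel_measurable (W {0..s})" "x r \<in> borel_measurable (W {0..s})"
        using X[of "Suc r" "{0..s}"] Suc.prems IH(1) by auto
      have "(\<lambda>\<omega>. A *v x r \<omega> + B *v u r \<omega> + w r \<omega>) \<in> borel_measurable (W {0..s})"
        by measurable
      \<comment> \<open>The dynamics hold at every point of the space, so measurability transfers
        without completing the sigma-algebra.\<close>
      then have "x (Suc r) \<in> borel_measurable (W {0..s})"
        by (rule measurable_cong[THEN iffD1, rotated]) (use dynamics Suc.prems sN in auto)
      then show ?case
        using IH ur by (auto simp: le_Suc_eq less_Suc_eq)
    qed
    then have "sets F \<subseteq> sets (W {0..s})"
      unfolding F_def by (intro sets_hist_algebra_subset) auto
    moreover have "sets (vimage_algebra (space M) (w s) borel) \<subseteq> sets (W {Suc s})"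
      using X[of "Suc s" "{Suc s}"] by (intro sets_image_in_sets) auto
    \<comment> \<open>Disjoint subfamilies of an independent family generate independent
      sigma-algebras.\<close>
    moreover have "indep_set (sets (W {0..s})) (sets (W {Suc s}))"
      using indep_var_restrict[OF indep, of "{0..s}" "{Suc s}"] sN
      unfolding indep_var_eq W_def sets_vimage_algebra by auto
    ultimately show ?thesis
      by (rule indep_set_mono[rotated])
  qed

  interpret noise: independent_noise M F d
    unfolding d_def using F_sub F_indep w_rv A2 sN by (intro centered_independent_noise) auto

  \<comment> \<open>Second moments of the trajectory\<close>
  have u_sq: "integrable M (\<lambda>\<omega>. (u r \<omega> $ a)\<^sup>2)" if "r < N" for r a
    using that A1 u_rv by (intro integrable_square_nth) (auto simp: L2_vec_def)
  have w_sq: "integrable M (\<lambda>\<omega>. (w r \<omega> $ a)\<^sup>2)" if "r < N" for r a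
    using that A2 w_rv by (intro integrable_square_nth integrable_norm_pow_le4[where j=2]) auto
  have x_sq: "integrable M (\<lambda>\<omega>. (x r \<omega> $ a)\<^sup>2)" if "r \<le> N" for r a
    using that
  proof (induction r arbitrary: a)
    case 0
    have [measurable]: "x 0 \<in> borel_measurable M" using x_rv by auto
    have "AE \<omega> in M. (x 0 \<omega> $ a)\<^sup>2 = (x0 $ a)\<^sup>2"
      using init by auto
    then show ?case
      by (subst integrable_cong_AE[where g="\<lambda>_. (x0 $ a)\<^sup>2"]) auto
  next
    case (Suc r)
    then have r: "r < N" "r \<le> N" by auto
    have [measurable]: "x r \<in> borel_measurable M" "u r \<in> borel_measurable M" "w r \<in> borel_measurable M"
      using r x_rv u_rv w_rv by auto
    have "integrable M (\<lambda>\<omega>. ((A *v x r \<omega>) $ a + (B *v u r \<omega>) $ a + w r \<omega> $ a)\<^sup>2)"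
      using r by (intro integrable_square_add integrable_square_matrix_vector Suc.IH u_sq w_sq) auto
    then show ?case
      using r dynamics by (subst Bochner_Integration.integrable_cong[OF refl]) auto
  qed

  \<comment> \<open>Splitting of the stacked state and of the cost\<close>
  define m where "m = (\<integral>\<omega>. w s \<omega> \<partial>M)"
  \<comment> \<open>Block 0 is the predicted state with the noise mean absorbed, so the remainder is
    exactly \<open>d\<close>. Block i >= 1 is the state at time \<open>t - i\<close>, at most
    \<open>s\<close>; truncated subtraction keeps this true for i > t as well.\<close>
  define y where "y \<omega> p = (if fst p = 0 then (A *v x s \<omega> + B *v u s \<omega> + m) $ snd p
      else x (t - fst p) \<omega> $ snd p)" for \<omega> and p :: "nat \<times> 'n"
  have eta: "eta x t \<omega> = (\<lambda>p. y \<omega> p + (if fst p = 0 then d \<omega> $ snd p else 0))"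
    if "\<omega> \<in> space M" for \<omega>
    using that dynamics sN by (auto simp: eta_def y_def d_def centered_def m_def t fun_eq_iff)
  have y_F: "(\<lambda>\<omega>. y \<omega> p) \<in> borel_measurable F" for p
  proof (cases "fst p = 0")
    case True
    have [measurable]: "x s \<in> borel_measurable F" "u s \<in> borel_measurable F"
      using A1 sN by (auto simp: F_def L2_vec_def intro: hist_algebra_state_measurable)
    show ?thesis
      unfolding y_def using True by simp
  next
    case False
    then have [measurable]: "x (t - fst p) \<in> borel_measurable F"
      by (auto simp: F_def t intro!: hist_algebra_state_measurable)
    show ?thesis
      unfolding y_def using False by simp
  qed
  have y_sq: "integrable M (\<lambda>\<omega>. (y \<omega> p)\<^sup>2)" for p
  proof (cases "fst p = 0")
    case True
    have [measurable]: "x s \<in> borel_measurable M" "u s \<in> borel_measurable M"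
      using x_rv u_rv sN by auto
    have "integrable M (\<lambda>\<omega>. ((A *v x s \<omega>) $ snd p + (B *v u s \<omega>) $ snd p + m $ snd p)\<^sup>2)"
      using sN by (intro integrable_square_add integrable_square_matrix_vector x_sq u_sq) auto
    then show ?thesis
      unfolding y_def using True by simp
  next
    case False
    then show ?thesis
      unfolding y_def using x_sq[of "t - fst p" "snd p"] sN t by simp
  qed
  have y_M: "(\<lambda>\<omega>. y \<omega> p) \<in> borel_measurable M" for p
    by (rule noise.measurable_F[OF y_F])

  define g where "g a \<omega> = row0 Q K (y \<omega>) a" for a \<omega>
  define c where "c \<omega> = quad_form ?I Q (y \<omega>)" for \<omega>
  have g_F: "g a \<in> borel_measurable F" for a
    unfolding g_def[abs_def] row0_def using y_F by auto
  have g_sq: "integrable M (\<lambda>\<omega>. (g a \<omega>)\<^sup>2)" for a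
    unfolding g_def[abs_def] row0_def using y_M y_sq
    by (intro integrable_square_sum) (auto simp: power_mult_distrib)
  have c_F: "c \<in> borel_measurable F"
    unfolding c_def[abs_def] quad_form_def using y_F by auto
  have c_int: "integrable M c"
  proof -
    have "integrable M (\<lambda>\<omega>. Q p q * (y \<omega> p * y \<omega> q))" for p q
      by (intro integrable_mult_right integrable_mult_of_squares y_M y_sq)
    then have "integrable M (\<lambda>\<omega>. y \<omega> p * Q p q * y \<omega> q)" for p q
      by (simp only: mult_ac)
    then show ?thesis
      unfolding c_def[abs_def] quad_form_def by (intro Bochner_Integration.integrable_sum)
  qed
  have z: "zcost k Q x t \<omega> = c \<omega> + 2 * (\<Sum>a\<in>UNIV. d \<omega> $ a * g a \<omega>) + d \<omega> \<bullet> (R *v d \<omega>)"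
    if "\<omega> \<in> space M" for \<omega>
    unfolding zcost_def K_def[symmetric] eta[OF that] c_def g_def R_def
    by (rule quad_form_add_first_block[OF sym])
  have z_M: "zcost k Q x t \<in> borel_measurable M"
  proof -
    have [measurable]: "x (t - i) \<in> borel_measurable M" for i
      using x_rv sN t by simp
    show ?thesis
      unfolding zcost_def[abs_def] quad_form_def eta_def case_prod_unfold by measurable
  qed

  \<comment> \<open>Identification of the noise statistics and of the right-hand side\<close>
  define G where "G a \<omega> = g a \<omega> + (R *v d \<omega>) $ a" for a \<omega>
  define \<gamma> where "\<gamma> a = (\<integral>\<omega>. (d \<omega> \<bullet> (R *v d \<omega>)) * d \<omega> $ a \<partial>M)" for a
  have ident_s: "distr M borel (w 0) = distr M borel (w s)" "w 0 \<in> borel_measurable M" "w s \<in> borel_measurable M"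
    using ident[rule_format, of 0 s] w_rv sN by simp_all
  have Sigma: "noise_Sigma M (w 0) = (\<chi> a b. noise.S a b)"
    unfolding noise_Sigma_cong_distr[OF ident_s] by (simp add: vec_eq_iff noise.noise_Sigma_nth[OF d_def])
  have gamma: "noise_gamma M R (w 0) $ a = \<gamma> a" for a
    unfolding noise_gamma_cong_distr[OF ident_s] \<gamma>_def by (rule noise.noise_gamma_nth[OF d_def])
  \<comment> \<open>Symmetry of the corner block reconciles the transpose in
    \<open>integral_quad_shifted\<close> with the square of Sigma Q00 in
    \<open>noise_theta\<close>.\<close>
  have theta: "noise_theta M R (w 0)
      = (\<integral>\<omega>. (d \<omega> \<bullet> (R *v d \<omega>) - (\<integral>\<xi>. d \<xi> \<bullet> (R *v d \<xi>) \<partial>M))\<^sup>2 \<partial>M)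
        - 4 * trace ((\<chi> a b. noise.S a b) ** transpose R ** ((\<chi> a b. noise.S a b) ** R))"
    unfolding noise_theta_def Sigma noise_delta_cong_distr[OF ident_s] R_sym
    by (simp add: noise.noise_delta_eq[OF d_def])

  let ?rhs = "\<lambda>\<omega>. quad_form ?I (H_mat M Q (w 0)) (eta x t \<omega>)
    + (\<Sum>p\<in>?I. zeta_vec M Q (w 0) p * eta x t \<omega> p)"
  let ?rhs' = "\<lambda>\<omega>. 4 * (\<Sum>a\<in>UNIV. \<Sum>b\<in>UNIV. noise.S a b * (G a \<omega> * G b \<omega>))
    + 4 * (\<Sum>a\<in>UNIV. \<gamma> a * G a \<omega>)"
  have rhs: "?rhs \<omega> = ?rhs' \<omega>" if "\<omega> \<in> space M" for \<omega>
  proof -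
    have "row0 Q K (eta x t \<omega>) a = G a \<omega>" for a
      unfolding eta[OF that] G_def g_def R_def by (rule row0_add_first_block)
    then show ?thesis
      by (simp add: quad_form_H_mat[OF sym] sum_zeta_vec[OF sym] Sigma gamma flip: R_def)
  qed
  have "integrable M ?rhs'"
    unfolding G_def by (rule noise.integrable_quad_shifted[OF g_F g_sq])
  then have rhs_int: "integrable M ?rhs"
    using rhs by (subst Bochner_Integration.integrable_cong[OF refl, of _ _ ?rhs']) auto
  have rhs_val: "(\<integral>\<omega>. ?rhs \<omega> \<partial>M) = (\<integral>\<omega>. ?rhs' \<omega> \<partial>M)"
    using rhs by (intro Bochner_Integration.integral_cong) auto
  have Delta: "Delta M k Q x u t = (\<lambda>\<omega>. zcost k Q x t \<omega> - real_cond_exp M F (zcost k Q x t) \<omega>)"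
    by (simp add: Delta_def fun_eq_iff F_def t)
  \<comment> \<open>Both sides share the terms in \<open>g\<close>. The trace created by passing
    from \<open>g\<close> to \<open>G\<close> cancels the one subtracted in
    \<open>noise_theta\<close>, leaving the variance of the quadratic noise term.\<close>
  have "(\<integral>\<omega>. (Delta M k Q x u t \<omega>)\<^sup>2 \<partial>M) = (\<integral>\<omega>. ?rhs \<omega> \<partial>M) + noise_theta M R (w 0)"
    unfolding rhs_val theta Delta G_def noise.integral_quad_shifted[OF g_F g_sq]
    using noise.integral_innovation_square[OF g_F g_sq c_F c_int z z_M] by (simp add: \<gamma>_def)
  moreover have "integrable M (\<lambda>\<omega>. (Delta M k Q x u t \<omega>)\<^sup>2)"
    unfolding Delta by (rule noise.integrable_innovation_square[OF g_F g_sq c_F c_int z z_M])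
  moreover have "H_mat M Q (w 0) \<in> sym_psd ?I"
    unfolding sym_psd_def
  proof (intro CollectI conjI ballI allI)
    fix p q :: "nat \<times> 'n" assume "p \<in> ?I" "q \<in> ?I"
    then have Qpq: "Q p (0, a) = Q (0, a) p" "Q (0, a) q = Q q (0, a)" for a
      by (auto intro!: sym simp: block_idx_def)
    show "H_mat M Q (w 0) p q = H_mat M Q (w 0) q p"
      unfolding H_mat_eq Qpq Sigma
      by (subst (2) sum.swap) (simp add: noise.S_sym mult.commute)
  next
    \<comment> \<open>The form is four times that of Sigma at the first block of
      \<open>Q v\<close>.\<close>
    show "0 \<le> quad_form ?I (H_mat M Q (w 0)) v" for v
      using noise.S_psd by (simp add: quad_form_H_mat[OF sym] Sigma)
  qed
  ultimately show "let I = block_idx (min k t); H = H_mat M Q (w 0); \<zeta> = zeta_vec M Q (w 0);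
         rhs = (\<lambda>\<omega>. quad_form I H (eta x t \<omega>) + (\<Sum>p\<in>I. \<zeta> p * eta x t \<omega> p))
     in H \<in> sym_psd I
        \<and> integrable M (\<lambda>\<omega>. (Delta M k Q x u t \<omega>)\<^sup>2)
        \<and> integrable M rhs
        \<and> (\<integral>\<omega>. (Delta M k Q x u t \<omega>)\<^sup>2 \<partial>M)
            = (\<integral>\<omega>. rhs \<omega> \<partial>M) + noise_theta M (blk Q 0 0) (w 0)"
    unfolding Let_def K_def[symmetric] R_def[symmetric] using rhs_int by blast
qed

end
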